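(* Let $\mathcal{S}$ be an FSA and $T_{\mathrm{spec}}\subset X\times X$. Then $\mathcal{S}$ is not strongly periodically D-detectable with respect to $T_{\mathrm{spec}}$ if and only if in its observer $\mathcal{S}_{obs}$ at least one of the two following conditions holds. (i) There is a reachable state $q\in 2^X$ in $\mathcal{S}_{obs}$ and $x\in q$ such that $(q\times q)\cap T_{\mathrm{spec}}\neq\emptyset$ and there is a transition sequence $x\xrightarrow{s_1}x'\xrightarrow{s_2}x'$ in $\mathcal{S}$ for some $s_1\in(T_{uo})^*$, $s_2\in(T_{uo})^+$, $x'\in X$. (ii) There is a reachable transition cycle in $\mathcal{S}_{obs}$ such that each state $q$ of the cycle satisfies $(q\times q)\cap T_{\mathrm{spec}}\neq\emptyset$.
   Context: The symbol $\subset$ denotes the (not necessarily proper) subset relation. For a finite alphabet $A$, $A^*$ and $A^\omega$ denote the sets of finite words (including the empty word $\epsilon$) and of infinite sequences over $A$, and $A^+=A^*\setminus\{\epsilon\}$. For $s\in A^*\cup A^\omega$, $s'\sqsubset s$ means that $s'\in A^*$ is a (not necessarily proper) prefix of $s$. $|s|$ is the length of a word $s$; $2^S$ is the power set of a set $S$. A finite-state automaton (FSA) is a sextuple $\mathcal{S}=(X,T,X_0,\delta,\Sigma,\ell)$, where $X$ is a finite set of states, $T$ a finite set of events, $X_0\subset X$ a set of initial states, $\delta\subset X\times T\times X$ a transition relation, $\Sigma$ a finite set of outputs (labels), and $\ell:T\to\Sigma\cup\{\epsilon\}$ a labeling function, extended to $\ell:T^*\cup T^\omega\to\Sigma^*\cup\Sigma^\omega$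 by $\ell(t_1t_2\dots)=\ell(t_1)\ell(t_2)\dots$, $\ell(\epsilon)=\epsilon$ (a sequence in $T^\omega$ may have a finite label sequence). $T_{uo}=\{t\in T:\ell(t)=\epsilon\}$ is the set of unobservable events. $\delta$ is extended to $\delta\subset X\times T^*\times X$ in the usual way; $x\xrightarrow{s}x'$ means $(x,s,x')\in\delta$. $L^\omega(\mathcal{S})=\{t_1t_2\dots\in T^\omega : \exists x_0\in X_0,\ \exists x_1,x_2,\dots\in X,\ x_0\xrightarrow{t_1}x_1\xrightarrow{t_2}\cdots\}$. For $\sigma\in\Sigma^*$, the current-state estimate is $\mathcal{M}(\mathcal{S},\sigma)=\{x\in X : \exists x_0\in X_0,\ \exists s\in T^*,\ \ell(s)=\sigma \text{ and } x_0\xrightarrow{s}x\}$. $T_{\mathrm{spec}}\subset X\times X$ is a specified set of crucial state pairs. $\mathcal{S}$ is strongly periodically D-detectable with respect to $T_{\mathrm{spec}}$ if there exists a positive integer $k$ such that for each $s\in L^\omega(\mathcal{S})$ and each finite prefix $s'\sqsubset s$, there is $s''\in T^*$ such that $|\ell(s'')|<k$, $s's''\sqsubset s$, and $(\mathcal{M}(\mathcal{S},\ell(s's''))\times\mathcal{M}(\mathcal{S},\ell(s's'')))\cap T_{\mathrm{spec}}=\emptyset$. The observer $\mathcal{S}_{obs}=(2^X\setminus\{\emptyset\},\Sigma,\mathcal{M}(\mathcal{S},\epsilon),\delta_{obs})$ is the deterministic automaton with unique initial state $\mathcal{M}(\mathcal{S},\epsilon)$ such that for all nonempty $X'\in 2^X$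 and $\sigma\in\Sigma^*$, $\delta_{obs}(\mathcal{M}(\mathcal{S},\epsilon),\sigma)=X'$ if and only if $X'=\mathcal{M}(\mathcal{S},\sigma)$; that is, its transitions are $(\mathcal{M}(\mathcal{S},\tau),a,\mathcal{M}(\mathcal{S},\tau a))$ for $\tau\in\Sigma^*$, $a\in\Sigma$ with $\mathcal{M}(\mathcal{S},\tau a)\ne\emptyset$. In an automaton, a state is reachable if it is initial or can be reached from an initial state by a transition sequence. A transition cycle is a transition sequence of positive length from a state to itself; the states of the cycle are all states visited along it; it is reachable if its states are reachable. *)

theory Defs
  imports Main "HOL-Library.Omega_Words_Fun"
begin

section \<open>Automata and transition sequences\<close>

record ('q, 'a) automaton =
  states :: "'q set"
  alphabet :: "'a set"
  initials :: "'q set"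
  trans_rel :: "('q \<times> 'a \<times> 'q) set"

text \<open>\<open>path A w qs\<close> is a transition sequence reading \<open>w\<close>; the list \<open>qs\<close> consists of all states
  visited, including the first and the last one.\<close>

definition path :: "('q, 'a, 'z) automaton_scheme \<Rightarrow> 'a list \<Rightarrow> 'q list \<Rightarrow> bool" where
  "path A w qs \<longleftrightarrow> length qs = Suc (length w) \<and> set qs \<subseteq> states A \<and>
     (\<forall>i < length w. (qs ! i, w ! i, qs ! Suc i) \<in> trans_rel A)"

text \<open>The extension of the transition relation to finite words.\<close>

definition steps :: "('q, 'a, 'z) automaton_scheme \<Rightarrow> 'q \<Rightarrow> 'a list \<Rightarrow> 'q \<Rightarrow> bool" where
  "steps A x w x' \<longleftrightarrow> (\<exists>qs. path A w qs \<and> hd qs = x \<and> last qs = x')"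

definition reachable :: "('q, 'a, 'z) automaton_scheme \<Rightarrow> 'q \<Rightarrow> bool" where
  "reachable A q \<longleftrightarrow> q \<in> states A \<and> (\<exists>q0 \<in> initials A. \<exists>w. steps A q0 w q)"

definition transition_cycle :: "('q, 'a, 'z) automaton_scheme \<Rightarrow> 'a list \<Rightarrow> 'q list \<Rightarrow> bool" where
  "transition_cycle A w qs \<longleftrightarrow> path A w qs \<and> w \<noteq> [] \<and> hd qs = last qs"

definition reachable_cycle :: "('q, 'a, 'z) automaton_scheme \<Rightarrow> 'a list \<Rightarrow> 'q list \<Rightarrow> bool" where
  "reachable_cycle A w qs \<longleftrightarrow> transition_cycle A w qs \<and> (\<forall>q \<in> set qs. reachable A q)"


section \<open>Labeled finite-state automata\<close>

text \<open>The alphabet of the underlying automaton is the set of events \<open>T\<close>.  The labeling function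
  has values in \<open>\<Sigma> \<union> {\<epsilon>}\<close>; \<open>None\<close> stands for \<open>\<epsilon>\<close>.\<close>

record ('x, 't, 'o) fsa = "('x, 't) automaton" +
  outputs :: "'o set"
  label :: "'t \<Rightarrow> 'o option"

definition is_fsa :: "('x, 't, 'o) fsa \<Rightarrow> bool" where
  "is_fsa S \<longleftrightarrow> finite (states S) \<and> finite (alphabet S) \<and> finite (outputs S) \<and>
     initials S \<subseteq> states S \<and> trans_rel S \<subseteq> states S \<times> alphabet S \<times> states S \<and>
     label S ` alphabet S \<subseteq> insert None (Some ` outputs S)"

definition label_word :: "('x, 't, 'o) fsa \<Rightarrow> 't list \<Rightarrow> 'o list" where
  "label_word S s = List.map_filter (label S) s"

definition unobservable :: "('x, 't, 'o) fsa \<Rightarrow> 't set" where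
  "unobservable S = {t \<in> alphabet S. label S t = None}"

definition omega_language :: "('x, 't, 'o) fsa \<Rightarrow> 't word set" where
  "omega_language S = {s. range s \<subseteq> alphabet S \<and>
     (\<exists>r. r 0 \<in> initials S \<and> range r \<subseteq> states S \<and>
          (\<forall>i. (r i, s i, r (Suc i)) \<in> trans_rel S))}"

definition state_estimate :: "('x, 't, 'o) fsa \<Rightarrow> 'o list \<Rightarrow> 'x set" where
  "state_estimate S \<sigma> = {x \<in> states S.
     \<exists>x0 \<in> initials S. \<exists>s \<in> lists (alphabet S). label_word S s = \<sigma> \<and> steps S x0 s x}"

definition prefix_of_omega :: "'a list \<Rightarrow> 'a word \<Rightarrow> bool" where
  "prefix_of_omega u s \<longleftrightarrow> u = prefix (length u) s"

definition strongly_periodically_D_detectable ::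
    "('x, 't, 'o) fsa \<Rightarrow> ('x \<times> 'x) set \<Rightarrow> bool" where
  "strongly_periodically_D_detectable S Tspec \<longleftrightarrow>
     (\<exists>k::nat. k > 0 \<and>
       (\<forall>s \<in> omega_language S. \<forall>s'. prefix_of_omega s' s \<longrightarrow>
         (\<exists>s'' \<in> lists (alphabet S). length (label_word S s'') < k \<and>
            prefix_of_omega (s' @ s'') s \<and>
            (state_estimate S (label_word S (s' @ s'')) \<times>
             state_estimate S (label_word S (s' @ s''))) \<inter> Tspec = {})))"

text \<open>If \<open>S\<close> has no initial state, then all state estimates are empty; the nominal initial state
  \<open>{}\<close> of the observer is then not among its states, and the observer has no reachable state.\<close>

definition observer :: "('x, 't, 'o) fsa \<Rightarrow> ('x set, 'o) automaton" where
  "observer S = \<lparr>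
     states = Pow (states S) - {{}},
     alphabet = outputs S,
     initials = {state_estimate S []},
     trans_rel = {(state_estimate S \<tau>, a, state_estimate S (\<tau> @ [a])) | \<tau> a.
        \<tau> \<in> lists (outputs S) \<and> a \<in> outputs S \<and> state_estimate S (\<tau> @ [a]) \<noteq> {}}\<rparr>"

end

theory Submission
  imports Defs
begin

text \<open>Either cycle yields an eventually periodic event sequence whose estimates are all bad from some
  point on: an unobservable cycle of \<open>S\<close> freezes the estimate, and a cycle of the observer lifts to
  a cycle of \<open>S\<close> because each state of an estimate is reached from some state of the preceding one.
  Conversely, if detectability fails for a bound larger than the number of sets of states, then some
  event sequence has only bad estimates along that many consecutive outputs, or along all that is
  left of it when it has fewer outputs left.  In the first case two of the estimates coincide and
  close a cycle of the observer; in the second case the sequence is eventually unobservable, and a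
  state of its run is repeated.\<close>

section \<open>Transition sequences, by recursion on the word\<close>

lemma path_Nil: "path A [] qs \<longleftrightarrow> (\<exists>x\<in>states A. qs = [x])"
  unfolding path_def by (auto simp: length_Suc_conv)

lemma path_Cons:
  "path A (a # w) qs \<longleftrightarrow>
     (\<exists>x qs'. qs = x # qs' \<and> x \<in> states A \<and> (x, a, hd qs') \<in> trans_rel A \<and> path A w qs')"
proof -
  have "(\<forall>i < Suc (length w). ((x # qs') ! i, (a # w) ! i, qs' ! i) \<in> trans_rel A) \<longleftrightarrow>
      (x, a, hd qs') \<in> trans_rel A \<and>
      (\<forall>i < length w. (qs' ! i, w ! i, qs' ! Suc i) \<in> trans_rel A)"
    if "length qs' = Suc (length w)" for x qs'
    using that by (cases qs') (auto simp: less_Suc_eq_0_disj)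
  then show ?thesis
    unfolding path_def by (cases qs) auto
qed

lemma path_not_Nil: "path A w qs \<Longrightarrow> qs \<noteq> []"
  unfolding path_def by auto

lemma steps_Nil: "steps A x [] y \<longleftrightarrow> x \<in> states A \<and> x = y"
  unfolding steps_def path_Nil by auto

text \<open>Together with \<open>steps_Nil\<close> this trades the state lists of
  \<open>path\<close> for recursion on the word, the form that later inductions use.\<close>

lemma steps_Cons:
  "steps A x (a # w) y \<longleftrightarrow> x \<in> states A \<and> (\<exists>z. (x, a, z) \<in> trans_rel A \<and> steps A z w y)"
proof
  assume "steps A x (a # w) y"
  then show "x \<in> states A \<and> (\<exists>z. (x, a, z) \<in> trans_rel A \<and> steps A z w y)"
    unfolding steps_def path_Cons using path_not_Nil by fastforce
next
  assume "x \<in> states A \<and> (\<exists>z. (x, a, z) \<in> trans_rel A \<and> steps A z w y)"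
  then obtain qs where "x \<in> states A" "(x, a, hd qs) \<in> trans_rel A" "path A w qs" "last qs = y"
    unfolding steps_def by auto
  then have "path A (a # w) (x # qs) \<and> hd (x # qs) = x \<and> last (x # qs) = y"
    using path_not_Nil by (auto simp: path_Cons)
  then show "steps A x (a # w) y"
    unfolding steps_def by blast
qed

lemma steps_states: "steps A x w y \<Longrightarrow> x \<in> states A \<and> y \<in> states A"
  by (induction w arbitrary: x) (auto simp: steps_Nil steps_Cons)

lemma steps_append: "steps A x (u @ v) y \<longleftrightarrow> (\<exists>z. steps A x u z \<and> steps A z v y)"
proof (induction u arbitrary: x)
  case Nil
  then show ?case using steps_states by (fastforce simp: steps_Nil)
next
  case (Cons a u)
  then show ?case by (auto simp: steps_Cons)
qed

lemma steps_in_lists: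
  assumes "is_fsa S" "steps S x w y"
  shows "w \<in> lists (alphabet S)"
  using assms(2)
proof (induction w arbitrary: x)
  case (Cons a w)
  then show ?case using assms(1) by (auto simp: steps_Cons is_fsa_def)
qed simp

section \<open>Label words\<close>

lemma label_word_Nil [simp]: "label_word S [] = []"
  by (simp add: label_word_def)

lemma label_word_Cons:
  "label_word S (t # s) = (case label S t of None \<Rightarrow> label_word S s | Some a \<Rightarrow> a # label_word S s)"
  by (simp add: label_word_def split: option.split)

lemma label_word_append [simp]: "label_word S (u @ v) = label_word S u @ label_word S v"
  by (simp add: label_word_def List.map_filter_def)

text \<open>Unobservable events leave several places to cut \<open>s\<close>. The induction takes
  the earliest one, with \<open>s1\<close> empty as soon as \<open>u\<close> is used up.\<close>

lemma label_word_eq_append: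
  "label_word S s = u @ v \<Longrightarrow> \<exists>s1 s2. s = s1 @ s2 \<and> label_word S s1 = u \<and> label_word S s2 = v"
proof (induction s arbitrary: u)
  case (Cons t s)
  show ?case
  proof (cases "u = []")
    case True
    then show ?thesis using Cons.prems by (intro exI[of _ "[]"] exI[of _ "t # s"]) auto
  next
    case False
    obtain u' where u': "label_word S s = u' @ v"
      "u = (case label S t of None \<Rightarrow> u' | Some a \<Rightarrow> a # u')"
      using Cons.prems False
      by (auto simp: label_word_Cons Cons_eq_append_conv split: option.splits)
    then obtain s1 s2 where "s = s1 @ s2" "label_word S s1 = u'" "label_word S s2 = v"
      using Cons.IH by blast
    then have "t # s = (t # s1) @ s2 \<and> label_word S (t # s1) = u \<and> label_word S s2 = v"
      using u' by (simp add: label_word_Cons split: option.split)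
    then show ?thesis by blast
  qed
qed simp

lemma label_word_in_lists:
  assumes "is_fsa S" "s \<in> lists (alphabet S)"
  shows "label_word S s \<in> lists (outputs S)"
  using assms(2)
proof (induction s)
  case (Cons t s)
  then have "label S t \<in> insert None (Some ` outputs S)"
    using assms(1) by (auto simp: is_fsa_def)
  then show ?case using Cons.IH by (auto simp: label_word_Cons)
qed simp

lemma label_word_concat_replicate:
  "label_word S (concat (replicate n v)) = concat (replicate n (label_word S v))"
  by (induction n) auto

lemma label_word_unobservable:
  "s \<in> lists (alphabet S) \<Longrightarrow> label_word S s = [] \<longleftrightarrow> s \<in> lists (unobservable S)"
  by (induction s) (auto simp: label_word_Cons unobservable_def split: option.splits)

lemma unobservable_lists:
  assumes "s \<in> lists (unobservable S)"
  shows "s \<in> lists (alphabet S)" "label_word S s = []"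
proof -
  show "s \<in> lists (alphabet S)"
    using assms by (auto simp: unobservable_def)
  then show "label_word S s = []"
    using assms by (simp only: label_word_unobservable)
qed

section \<open>Current-state estimates\<close>

lemma state_estimate_iff:
  assumes "is_fsa S"
  shows "y \<in> state_estimate S \<sigma> \<longleftrightarrow> (\<exists>x0\<in>initials S. \<exists>s. label_word S s = \<sigma> \<and> steps S x0 s y)"
proof -
  have "y \<in> states S" "s \<in> lists (alphabet S)" if "steps S x0 s y" for x0 s
    using steps_states[OF that] steps_in_lists[OF assms that] by auto
  then show ?thesis
    unfolding state_estimate_def by blast
qed

text \<open>Cutting event words where their labels complete \<open>\<sigma>\<close> shows that the
  new estimate depends on the old one and \<open>\<tau>\<close> only. This is what makes the
  observer deterministic.\<close>

lemma state_estimate_append: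
  assumes "is_fsa S"
  shows "state_estimate S (\<sigma> @ \<tau>) =
    {y. \<exists>x\<in>state_estimate S \<sigma>. \<exists>s. label_word S s = \<tau> \<and> steps S x s y}" (is "?L = ?R")
proof (intro equalityI subsetI)
  fix y assume "y \<in> ?L"
  then obtain x0 s where s: "x0 \<in> initials S" "label_word S s = \<sigma> @ \<tau>" "steps S x0 s y"
    using state_estimate_iff[OF assms] by blast
  then obtain u v where uv: "s = u @ v" "label_word S u = \<sigma>" "label_word S v = \<tau>"
    using label_word_eq_append[OF s(2)] by blast
  then obtain x where x: "steps S x0 u x" "steps S x v y"
    using s(3) steps_append[of S x0 u v y] by blast
  then have "x \<in> state_estimate S \<sigma>"
    using s(1) uv(2) state_estimate_iff[OF assms] by blast
  then show "y \<in> ?R"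
    using x(2) uv(3) by blast
next
  fix y assume "y \<in> ?R"
  then obtain x s where "x \<in> state_estimate S \<sigma>" "label_word S s = \<tau>" "steps S x s y"
    by blast
  moreover from this(1) obtain x0 u where "x0 \<in> initials S" "label_word S u = \<sigma>" "steps S x0 u x"
    using state_estimate_iff[OF assms] by blast
  ultimately have "label_word S (u @ s) = \<sigma> @ \<tau>" "steps S x0 (u @ s) y"
    by (auto simp: steps_append)
  then show "y \<in> ?L"
    using \<open>x0 \<in> initials S\<close> state_estimate_iff[OF assms] by blast
qed

text \<open>Label words with equal estimates have the same future. This permits changing the
  representative of an observer state and cutting out loops of the observer.\<close>

lemma state_estimate_append_cong:
  assumes "is_fsa S" "state_estimate S \<sigma> = state_estimate S \<sigma>'"
  shows "state_estimate S (\<sigma> @ \<tau>) = state_estimate S (\<sigma>' @ \<tau>)"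
  using assms by (simp add: state_estimate_append)

lemma state_estimate_append_eq_empty:
  assumes "is_fsa S" "state_estimate S \<sigma> = {}"
  shows "state_estimate S (\<sigma> @ \<tau>) = {}"
  using assms by (simp add: state_estimate_append)

lemma state_estimate_subset: "state_estimate S \<sigma> \<subseteq> states S"
  by (auto simp: state_estimate_def)

section \<open>Paths of the observer as estimates of prefixes\<close>

lemma path_observer_nth:
  assumes "is_fsa S" "path (observer S) w qs" "hd qs = state_estimate S \<sigma>"
  shows "w \<in> lists (outputs S) \<and> (\<forall>i\<le>length w. qs ! i = state_estimate S (\<sigma> @ take i w))"
  using assms(2,3)
proof (induction w arbitrary: \<sigma> qs)
  case Nil
  then obtain x where "qs = [x]"
    by (elim path_Nil[THEN iffD1, THEN bexE])
  with Nil.prems(2) show ?case by simp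
next
  case (Cons a w)
  from Cons.prems obtain qs' where qs': "qs = state_estimate S \<sigma> # qs'"
    "(state_estimate S \<sigma>, a, hd qs') \<in> trans_rel (observer S)" "path (observer S) w qs'"
    unfolding path_Cons by (elim exE conjE) simp
  \<comment> \<open>An observer transition only names some \<open>\<tau>\<close> whose estimate is
    the source, perhaps not \<open>\<sigma>\<close>. The congruence lemma moves the target back to
    \<open>\<sigma>\<close>.\<close>
  then obtain \<tau> where \<tau>: "state_estimate S \<sigma> = state_estimate S \<tau>" "a \<in> outputs S"
    "hd qs' = state_estimate S (\<tau> @ [a])"
    unfolding observer_def automaton.simps by blast
  then have "hd qs' = state_estimate S (\<sigma> @ [a])" "a \<in> outputs S"
    using state_estimate_append_cong[OF assms(1) \<tau>(1)] by simp_all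
  with Cons.IH[OF qs'(3), of "\<sigma> @ [a]"]
  have IH: "w \<in> lists (outputs S)" "a \<in> outputs S"
    "\<And>i. i \<le> length w \<Longrightarrow> qs' ! i = state_estimate S ((\<sigma> @ [a]) @ take i w)"
    by simp_all
  then have "qs ! i = state_estimate S (\<sigma> @ take i (a # w))" if "i \<le> length (a # w)" for i
    using that qs'(1) by (cases i) auto
  with IH(1,2) show ?case by simp
qed

lemma path_observerI:
  assumes "is_fsa S" "\<sigma> \<in> lists (outputs S)" "w \<in> lists (outputs S)"
    and "state_estimate S (\<sigma> @ w) \<noteq> {}"
  shows "path (observer S) w (map (\<lambda>i. state_estimate S (\<sigma> @ take i w)) [0..<Suc (length w)])"
    (is "path _ _ (map ?M _)")
proof -
  \<comment> \<open>Once empty, an estimate stays empty, so nonemptiness at the end of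
    \<open>w\<close> gives it at every earlier prefix.\<close>
  have ne: "?M i \<noteq> {}" for i
    using state_estimate_append_eq_empty[OF assms(1), of "\<sigma> @ take i w" "drop i w"] assms(4)
    by auto
  have "(?M i, w ! i, ?M (Suc i)) \<in> trans_rel (observer S)" if "i < length w" for i
  proof -
    have eq: "\<sigma> @ take (Suc i) w = (\<sigma> @ take i w) @ [w ! i]"
      using that by (simp add: take_Suc_conv_app_nth)
    moreover have "w ! i \<in> outputs S" "\<sigma> @ take i w \<in> lists (outputs S)"
      using assms(2,3) that by (auto dest: in_set_takeD)
    ultimately show ?thesis
      using ne[of "Suc i"] unfolding eq observer_def automaton.simps by blast
  qed
  moreover have "?M i \<in> states (observer S)" for i
    using ne state_estimate_subset by (simp add: observer_def)
  ultimately show ?thesis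
    unfolding path_def by (auto simp del: upt_Suc)
qed

text \<open>Both preceding lemmas are used with \<open>[]\<close> as starting label word. The
  condition \<open>q \<noteq> {}\<close> reflects that the observer excludes the empty set, which
  matters when there is no initial state.\<close>

lemma reachable_observer_iff:
  assumes "is_fsa S"
  shows "reachable (observer S) q \<longleftrightarrow>
    q \<noteq> {} \<and> (\<exists>\<sigma>\<in>lists (outputs S). q = state_estimate S \<sigma>)" (is "?L \<longleftrightarrow> ?R")
proof
  assume ?L
  then obtain w qs where q: "q \<noteq> {}" "path (observer S) w qs" "hd qs = state_estimate S []"
    "last qs = q"
    by (auto simp: reachable_def steps_def observer_def)
  then have "w \<in> lists (outputs S)" "qs ! length w = state_estimate S w" "last qs = qs ! length w"
    using path_observer_nth[OF assms q(2,3)] path_not_Nil[OF q(2)]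
    by (auto simp: last_conv_nth path_def)
  then show ?R using q by auto
next
  assume ?R
  then obtain \<sigma> where \<sigma>: "\<sigma> \<in> lists (outputs S)" "q = state_estimate S \<sigma>" "q \<noteq> {}"
    by blast
  let ?qs = "map (\<lambda>i. state_estimate S ([] @ take i \<sigma>)) [0..<Suc (length \<sigma>)]"
  have "path (observer S) \<sigma> ?qs"
    using path_observerI[OF assms, of "[]" \<sigma>] \<sigma> by auto
  moreover have "hd ?qs = state_estimate S []" "last ?qs = q"
    using \<sigma> by (simp_all add: hd_map del: upt_Suc) (simp add: last_map)
  ultimately have "steps (observer S) (state_estimate S []) \<sigma> q"
    unfolding steps_def by blast
  then show ?L
    using steps_states by (fastforce simp: reachable_def observer_def)
qed

section \<open>Infinite runs\<close>

text \<open>Unlike in \<open>omega_language\<close>, the first state is a parameter and need not be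
  initial, so that runs can be attached behind finite transition sequences.\<close>

definition run_from :: "('q, 'a, 'z) automaton_scheme \<Rightarrow> 'q \<Rightarrow> 'a word \<Rightarrow> bool" where
  "run_from A x s \<longleftrightarrow>
     (\<exists>r. r 0 = x \<and> range r \<subseteq> states A \<and> (\<forall>i. (r i, s i, r (Suc i)) \<in> trans_rel A))"

lemma run_from_conc: "steps A x u y \<Longrightarrow> run_from A y s \<Longrightarrow> run_from A x (u \<frown> s)"
proof (induction u arbitrary: x)
  case Nil
  then show ?case by (simp add: steps_Nil)
next
  case (Cons a u)
  then obtain z where z: "x \<in> states A" "(x, a, z) \<in> trans_rel A" "run_from A z (u \<frown> s)"
    by (auto simp: steps_Cons)
  then obtain r where r: "r 0 = z" "range r \<subseteq> states A"
    "\<forall>i. (r i, (u \<frown> s) i, r (Suc i)) \<in> trans_rel A"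
    by (auto simp: run_from_def)
  have "((x ## r) i, (a ## u \<frown> s) i, (x ## r) (Suc i)) \<in> trans_rel A" for i
    using z r by (cases i) auto
  moreover have "(x ## r) i \<in> states A" for i
    using z r by (cases i) auto
  ultimately show ?case
    unfolding run_from_def build_cons
    using z(1) r(2) by (intro exI[of _ "x ## r"]) (simp add: image_subset_iff)
qed

lemma run_from_iter:
  assumes "steps A x v x" "v \<noteq> []"
  shows "run_from A x (v\<^sup>\<omega>)"
proof -
  from assms obtain qs where qs: "path A v qs" "hd qs = x" "last qs = x"
    by (auto simp: steps_def)
  \<comment> \<open>The infinite run goes round the loop: its states are those of \<open>qs\<close>,
    indexed modulo the length of \<open>v\<close>.\<close>
  let ?n = "length v" and ?r = "\<lambda>i. qs ! (i mod length v)"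
  have n: "0 < ?n" "length qs = Suc ?n" using assms(2) qs(1) by (auto simp: path_def)
  have loop: "qs ! 0 = x" "qs ! ?n = x"
    using qs n path_not_Nil[OF qs(1)] by (auto simp: hd_conv_nth last_conv_nth)
  have "(?r i, v ! (i mod ?n), ?r (Suc i)) \<in> trans_rel A" for i
  proof -
    \<comment> \<open>At the wrap-around the left side is \<open>qs ! 0\<close> and the right side
      \<open>qs ! ?n\<close>; both are \<open>x\<close>.\<close>
    have "?r (Suc i) = qs ! Suc (i mod ?n)"
      using loop by (simp add: mod_Suc)
    moreover have "i mod ?n < ?n" using n by simp
    ultimately show ?thesis using qs(1) by (simp add: path_def)
  qed
  moreover have "?r i \<in> states A" for i
  proof -
    have "i mod ?n < length qs" using n by (simp add: less_SucI)
    then show ?thesis using qs(1) nth_mem by (fastforce simp: path_def)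
  qed
  ultimately show ?thesis
    unfolding run_from_def using loop n by (intro exI[of _ ?r]) auto
qed

lemma omega_languageI:
  assumes "is_fsa S" "x \<in> initials S" "run_from S x s"
  shows "s \<in> omega_language S"
proof -
  from assms(3) obtain r where r: "r 0 = x" "range r \<subseteq> states S"
    "\<forall>i. (r i, s i, r (Suc i)) \<in> trans_rel S"
    by (auto simp: run_from_def)
  then have "range s \<subseteq> alphabet S"
    using assms(1) by (auto simp: is_fsa_def)
  with r assms(2) show ?thesis by (auto simp: omega_language_def)
qed

lemma subsequence_split: "i \<le> j \<Longrightarrow> j \<le> k \<Longrightarrow> s[i \<rightarrow> k] = s[i \<rightarrow> j] @ s[j \<rightarrow> k]"
  using upt_add_eq_append[of i j "k - j"] by (simp add: subsequence_def)

lemma steps_subsequence: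
  assumes "\<And>i. (r i, s i, r (Suc i)) \<in> trans_rel A" "range r \<subseteq> states A" "i \<le> j"
  shows "steps A (r i) (s[i \<rightarrow> j]) (r j)"
  using assms(3)
proof (induction j rule: dec_induct)
  case base
  then show ?case using assms(2) by (auto simp: steps_Nil)
next
  case (step n)
  have "steps A (r n) [s n] (r (Suc n))"
    using assms(1,2) by (auto simp: steps_Cons steps_Nil)
  with step show ?case by (auto simp: steps_append)
qed

section \<open>Cycles refute detectability\<close>

text \<open>As \<open>v\<close> is nonempty, \<open>n\<close> copies of it have at least
  \<open>n\<close> letters and so cover the prefix of length \<open>n\<close>.\<close>

lemma prefix_iter:
  assumes "v \<noteq> []"
  shows "\<exists>z. prefix n (v\<^sup>\<omega>) @ z = concat (replicate n v)"
proof -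
  have "v\<^sup>\<omega> = concat (replicate m v) \<frown> v\<^sup>\<omega>" for m
  proof (induction m)
    case (Suc m)
    then show ?case
      using iter_unroll[of v] assms
      by (metis concat.simps(2) conc_conc length_greater_0_conv replicate_Suc)
  qed simp
  moreover have "n \<le> length (concat (replicate n v))"
    using assms by (induction n) (auto simp: Suc_le_eq add_strict_increasing)
  ultimately have "prefix n (v\<^sup>\<omega>) = take n (concat (replicate n v))"
    by (metis prefix_conc_fst)
  then show ?thesis by (metis append_take_drop_id)
qed

text \<open>The event sequence \<open>u v\<^sup>\<omega>\<close> refutes every bound \<open>k\<close> at once.\<close>

lemma lasso_not_detectable:
  assumes fsa: "is_fsa S" and x0: "x0 \<in> initials S"
    and u: "steps S x0 u x" and v: "steps S x v x" "v \<noteq> []"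
    and bad: "\<And>n \<tau> \<rho>. \<tau> @ \<rho> = concat (replicate n (label_word S v)) \<Longrightarrow>
      (state_estimate S (label_word S u @ \<tau>) \<times> state_estimate S (label_word S u @ \<tau>)) \<inter> Tspec \<noteq> {}"
  shows "\<not> strongly_periodically_D_detectable S Tspec"
proof -
  let ?s = "u \<frown> v\<^sup>\<omega>"
  have "?s \<in> omega_language S"
    using omega_languageI[OF fsa x0] run_from_conc[OF u] run_from_iter[OF v] by blast
  \<comment> \<open>The prefix that witnesses failure is \<open>u\<close>, whatever the bound
    \<open>k\<close>.\<close>
  moreover have "prefix_of_omega u ?s"
    by (simp add: prefix_of_omega_def)
  moreover have "(state_estimate S (label_word S (u @ s)) \<times>
      state_estimate S (label_word S (u @ s))) \<inter> Tspec \<noteq> {}"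
    if "prefix_of_omega (u @ s) ?s" for s
  proof -
    from that have s: "s = prefix (length s) (v\<^sup>\<omega>)"
      by (simp add: prefix_of_omega_def)
    then obtain z where "s @ z = concat (replicate (length s) v)"
      using prefix_iter[OF v(2)] by metis
    \<comment> \<open>Labeling commutes with powers, so the labels of \<open>s\<close> form a prefix
      of a power of the label of \<open>v\<close>, as \<open>bad\<close> requires.\<close>
    then have "label_word S s @ label_word S z = concat (replicate (length s) (label_word S v))"
      using label_word_concat_replicate by (metis label_word_append)
    from bad[OF this] show ?thesis by simp
  qed
  ultimately show ?thesis
    unfolding strongly_periodically_D_detectable_def by blast
qed

text \<open>The loop \<open>s2\<close> has empty label, so \<open>bad\<close> of the lasso lemma
  concerns \<open>\<tau> = []\<close> alone, that is, the estimate \<open>q\<close> itself.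
  Membership of \<open>x\<close> in \<open>q\<close> supplies the way from an initial state.\<close>

lemma unobservable_cycle_not_detectable:
  assumes fsa: "is_fsa S" and q: "reachable (observer S) q" "x \<in> q" "(q \<times> q) \<inter> Tspec \<noteq> {}"
    and s: "s1 \<in> lists (unobservable S)" "s2 \<in> lists (unobservable S)" "s2 \<noteq> []"
    and steps: "steps S x s1 x'" "steps S x' s2 x'"
  shows "\<not> strongly_periodically_D_detectable S Tspec"
proof -
  obtain \<sigma> where \<sigma>: "q = state_estimate S \<sigma>"
    using q(1) reachable_observer_iff[OF fsa] by blast
  then obtain x0 u where u: "x0 \<in> initials S" "label_word S u = \<sigma>" "steps S x0 u x"
    using q(2) state_estimate_iff[OF fsa] by blast
  have "steps S x0 (u @ s1) x'"
    using u(3) steps(1) steps_append by fastforce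
  moreover have "label_word S (u @ s1) = \<sigma>" "label_word S s2 = []"
    using u(2) s unobservable_lists(2) by simp_all
  ultimately show ?thesis
    using lasso_not_detectable[OF fsa u(1) _ steps(2) s(3)] q(3) \<sigma>
    by (auto simp: replicate_eq_replicate)
qed

text \<open>Every state of the estimate reached after \<open>w\<close> has a predecessor in the same estimate, so the
  one-step relation \<open>E\<close> has no minimal element on a finite nonempty set and hence is cyclic.\<close>

lemma state_estimate_loop:
  assumes fsa: "is_fsa S" and loop: "state_estimate S (\<sigma> @ w) = state_estimate S \<sigma>"
    and ne: "state_estimate S \<sigma> \<noteq> {}"
  shows "\<exists>x\<in>state_estimate S \<sigma>. \<exists>v m. 0 < m \<and> label_word S v = concat (replicate m w) \<and> steps S x v x"
proof -
  let ?q = "state_estimate S \<sigma>"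
  define E where "E = {(x, y) \<in> ?q \<times> ?q. \<exists>v. label_word S v = w \<and> steps S x v y}"
  have "finite ?q"
    using fsa finite_subset[OF state_estimate_subset[of S \<sigma>]] by (simp add: is_fsa_def)
  moreover have "E \<subseteq> ?q \<times> ?q"
    by (auto simp: E_def)
  ultimately have "finite E"
    using finite_subset[of E "?q \<times> ?q"] by simp
  have pred: "\<exists>x\<in>?q. (x, y) \<in> E" if "y \<in> ?q" for y
  proof -
    have "y \<in> state_estimate S (\<sigma> @ w)" using that loop by simp
    then obtain x v where "x \<in> ?q" "label_word S v = w" "steps S x v y"
      by (auto simp: state_estimate_append[OF fsa])
    with that show ?thesis by (auto simp: E_def)
  qed
  have "\<not> acyclic E"
  proof
    assume "acyclic E"
    with \<open>finite E\<close> have "wf E" by (rule finite_acyclic_wf)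
    \<comment> \<open>A minimal element of the estimate would contradict
      \<open>pred\<close>.\<close>
    then show False using ne pred by (metis ex_in_conv wfE_min)
  qed
  then obtain x where "(x, x) \<in> E\<^sup>+" by (auto simp: acyclic_def)
  \<comment> \<open>A closed walk of \<open>m\<close> edges of \<open>E\<close> reads
    \<open>m\<close> copies of \<open>w\<close>. The loop in \<open>S\<close> may thus need several
    rounds of the observer cycle.\<close>
  moreover have "\<exists>v m. 0 < m \<and> label_word S v = concat (replicate m w) \<and> steps S x v y"
    if "(x, y) \<in> E\<^sup>+" for x y
    using that
  proof (induction rule: trancl_induct)
    case (base y)
    then obtain v where "label_word S v = w" "steps S x v y" by (auto simp: E_def)
    then show ?case by (intro exI[of _ v] exI[of _ 1]) simp
  next
    case (step y z)
    then obtain v m v' where "label_word S v = concat (replicate m w)" "steps S x v y"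
      "label_word S v' = w" "steps S y v' z"
      by (auto simp: E_def)
    moreover have "concat (replicate m w) @ w = concat (replicate (Suc m) w)"
      by (metis append_Nil2 concat.simps concat_append replicate_Suc replicate_append_same)
    ultimately have "label_word S (v @ v') = concat (replicate (Suc m) w)" "steps S x (v @ v') z"
      by (auto simp: steps_append simp del: replicate_Suc)
    then show ?case by blast
  qed
  moreover have "x \<in> ?q" if "(x, x) \<in> E\<^sup>+" for x
    using tranclD[OF that] by (auto simp: E_def)
  ultimately show ?thesis by blast
qed

text \<open>Each full copy of \<open>w\<close> at the front of \<open>\<tau>\<close> leads back to
  the estimate of \<open>\<sigma>\<close> and can be removed. What remains is a prefix of
  \<open>w\<close>, whose estimate lies on the path.\<close>

lemma path_observer_iterate:
  assumes fsa: "is_fsa S" and qs: "path (observer S) w qs" "hd qs = state_estimate S \<sigma>"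
    and loop: "state_estimate S (\<sigma> @ w) = state_estimate S \<sigma>"
    and \<tau>: "\<tau> @ \<rho> = concat (replicate n w)"
  shows "state_estimate S (\<sigma> @ \<tau>) \<in> set qs"
  using \<tau>
proof (induction n arbitrary: \<tau>)
  case 0
  then show ?case using qs path_not_Nil[OF qs(1)] by (auto simp flip: qs(2))
next
  case (Suc n)
  show ?case
  proof (cases "length \<tau> \<le> length w")
    case True
    then have "\<tau> = take (length \<tau>) w"
      using Suc.prems by (metis append_eq_append_conv_if concat.simps(2) replicate_Suc)
    then have "state_estimate S (\<sigma> @ \<tau>) = qs ! length \<tau>"
      using path_observer_nth[OF fsa qs] True by auto
    then show ?thesis using True qs(1) by (simp add: path_def)
  next
    case False
    then obtain \<tau>' where \<tau>': "\<tau> = w @ \<tau>'" "\<tau>' @ \<rho> = concat (replicate n w)"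
      using Suc.prems by (auto simp: append_eq_append_conv2)
    then have "state_estimate S (\<sigma> @ \<tau>) = state_estimate S (\<sigma> @ \<tau>')"
      using state_estimate_append_cong[OF fsa loop, of \<tau>'] by simp
    then show ?thesis using Suc.IH[OF \<tau>'(2)] by simp
  qed
qed

text \<open>The cycle is lifted to a loop of \<open>S\<close> by \<open>state_estimate_loop\<close>.
  Although that loop reads a power of \<open>w\<close>, all estimates along it are states of
  \<open>qs\<close>, hence bad.\<close>

lemma observer_cycle_not_detectable:
  assumes fsa: "is_fsa S" and cyc: "reachable_cycle (observer S) w qs"
    and bad: "\<forall>q\<in>set qs. (q \<times> q) \<inter> Tspec \<noteq> {}"
  shows "\<not> strongly_periodically_D_detectable S Tspec"
proof -
  from cyc have qs: "path (observer S) w qs" "w \<noteq> []" "hd qs = last qs"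
    and reach: "\<forall>q\<in>set qs. reachable (observer S) q"
    by (simp_all add: reachable_cycle_def transition_cycle_def)
  then have "reachable (observer S) (hd qs)"
    using path_not_Nil hd_in_set by blast
  then obtain \<sigma> where \<sigma>: "hd qs = state_estimate S \<sigma>" "state_estimate S \<sigma> \<noteq> {}"
    using reachable_observer_iff[OF fsa] by metis
  have "last qs = state_estimate S (\<sigma> @ w)"
    using path_observer_nth[OF fsa qs(1) \<sigma>(1)] path_not_Nil[OF qs(1)] qs(1)
    by (auto simp: last_conv_nth path_def)
  then have loop: "state_estimate S (\<sigma> @ w) = state_estimate S \<sigma>"
    using qs(3) \<sigma>(1) by simp
  then obtain x v m where x: "x \<in> state_estimate S \<sigma>" "0 < m"
    "label_word S v = concat (replicate m w)" "steps S x v x"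
    using state_estimate_loop[OF fsa _ \<sigma>(2)] by blast
  then obtain x0 u where u: "x0 \<in> initials S" "label_word S u = \<sigma>" "steps S x0 u x"
    using state_estimate_iff[OF fsa] by blast
  \<comment> \<open>The label of \<open>v\<close> is a positive power of the nonempty word
    \<open>w\<close>.\<close>
  have "v \<noteq> []"
    using x(2,3) qs(2) by auto
  moreover have "concat (replicate n (label_word S v)) = concat (replicate (n * m) w)" for n
    unfolding x(3) by (induction n) (auto simp: replicate_add)
  ultimately show ?thesis
    using lasso_not_detectable[OF fsa u(1,3) x(4)] path_observer_iterate[OF fsa qs(1) \<sigma>(1) loop] bad u(2)
    by metis
qed

section \<open>Failure of detectability produces a cycle\<close>

text \<open>The number of outputs since position \<open>n\<close> is bounded and never decreases
  with \<open>j\<close>. After a position \<open>m\<close> where it is maximal, no further output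
  occurs.\<close>

lemma eventually_unobservable:
  assumes bound: "\<And>j. n \<le> j \<Longrightarrow> length (label_word S (s[n \<rightarrow> j])) < K"
  shows "\<exists>m\<ge>n. \<forall>i\<ge>m. \<forall>j\<ge>i. label_word S (s[i \<rightarrow> j]) = []"
proof -
  let ?f = "\<lambda>j. length (label_word S (s[n \<rightarrow> j]))"
  obtain m where m: "n \<le> m" "\<forall>j\<ge>n. ?f j \<le> ?f m"
    using ex_has_greatest_nat[of "\<lambda>j. n \<le> j" n ?f K] bound less_imp_le by blast
  have "label_word S (s[i \<rightarrow> j]) = []" if "m \<le> i" "i \<le> j" for i j
  proof -
    have "s[n \<rightarrow> j] = s[n \<rightarrow> m] @ s[m \<rightarrow> i] @ s[i \<rightarrow> j]"
      using m(1) that subsequence_split[of n m j s] subsequence_split[of m i j s] by simp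
    moreover have "?f j \<le> ?f m"
      using m that by simp
    ultimately show ?thesis by simp
  qed
  with m(1) show ?thesis by blast
qed

text \<open>Beyond the last output, infinitely many positions of the run share finitely many states.
  The events between two visits to one state form the cycle.\<close>

lemma unobservable_cycle_if_bounded:
  assumes fsa: "is_fsa S" and r: "r 0 \<in> initials S" "range r \<subseteq> states S"
      "\<And>i. (r i, s i, r (Suc i)) \<in> trans_rel S"
    and bound: "\<And>j. n \<le> j \<Longrightarrow> length (label_word S (s[n \<rightarrow> j])) < K"
  shows "\<exists>i\<ge>n. \<exists>s2\<in>lists (unobservable S) - {[]}. steps S (r i) s2 (r i)"
proof -
  obtain m where m: "n \<le> m" "\<And>i j. m \<le> i \<Longrightarrow> i \<le> j \<Longrightarrow> label_word S (s[i \<rightarrow> j]) = []"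
    using eventually_unobservable[OF bound] by blast
  have "finite (r ` {m..})"
    using fsa r(2) by (auto simp: is_fsa_def intro: finite_subset)
  then have "\<not> inj_on r {m..}"
    using finite_imageD infinite_Ici by blast
  then obtain i j where ij: "m \<le> i" "i < j" "r i = r j"
    unfolding inj_on_def by (metis atLeast_iff linorder_neqE_nat)
  have "steps S (r i) (s[i \<rightarrow> j]) (r i)"
    using steps_subsequence[of r s S i j] r ij by auto
  moreover have "s[i \<rightarrow> j] \<in> lists (unobservable S) - {[]}"
    using label_word_unobservable[OF steps_in_lists[OF fsa calculation]] m(2) ij by auto
  ultimately show ?thesis
    using m(1) ij(1) le_trans by blast
qed

text \<open>Pigeonhole: \<open>v\<close> has one more prefix than letters, hence more prefixes than
  there are sets of states. Two prefixes share an estimate, and the letters between them label the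
  cycle.\<close>

lemma observer_cycle_if_long:
  assumes fsa: "is_fsa S" and \<sigma>: "\<sigma> \<in> lists (outputs S)" and v: "v \<in> lists (outputs S)"
    and ne: "state_estimate S (\<sigma> @ v) \<noteq> {}" and long: "card (Pow (states S)) \<le> length v"
  shows "\<exists>w qs. reachable_cycle (observer S) w qs \<and>
    set qs \<subseteq> (\<lambda>j. state_estimate S (\<sigma> @ take j v)) ` {..length v}"
proof -
  let ?M = "\<lambda>j. state_estimate S (\<sigma> @ take j v)"
  have "?M ` {..length v} \<subseteq> Pow (states S)"
    using state_estimate_subset[of S] by auto
  moreover have "finite (Pow (states S))"
    using fsa by (simp add: is_fsa_def)
  ultimately have "inj_on ?M {..length v} \<Longrightarrow> card {..length v} \<le> card (Pow (states S))"
    using card_inj_on_le by blast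
  then have "\<not> inj_on ?M {..length v}"
    using long by auto
  then obtain i j where ij: "i < j" "j \<le> length v" "?M i = ?M j"
    unfolding inj_on_def by (metis atMost_iff linorder_neqE_nat)
  define w where "w = drop i (take j v)"
  let ?qs = "map (\<lambda>l. state_estimate S ((\<sigma> @ take i v) @ take l w)) [0..<Suc (length w)]"
  have len: "length w = j - i" using ij by (simp add: w_def)
  have M: "state_estimate S ((\<sigma> @ take i v) @ take l w) = ?M (i + l)" if "l \<le> length w" for l
  proof -
    have "take (i + l) v = take i v @ take l w"
      using that len by (simp add: w_def take_add drop_take min_absorb1)
    then show ?thesis by simp
  qed
  have ne': "?M l \<noteq> {}" for l
    using state_estimate_append_eq_empty[OF fsa, of "\<sigma> @ take l v" "drop l v"] ne by auto
  have lists: "\<sigma> @ take l v \<in> lists (outputs S)" "w \<in> lists (outputs S)" for l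
    using \<sigma> v unfolding w_def by (auto dest: in_set_takeD in_set_dropD)
  have "state_estimate S ((\<sigma> @ take i v) @ w) \<noteq> {}"
    using M[of "length w"] ne' by simp
  then have "path (observer S) w ?qs"
    by (rule path_observerI[OF fsa lists])
  \<comment> \<open>Reindexing by \<open>i\<close> exhibits the states of the path as estimates of
    prefixes of \<open>v\<close>.\<close>
  moreover have "?qs = map (\<lambda>l. ?M (i + l)) [0..<Suc (length w)]"
    by (rule map_cong[OF refl], rule M) (simp only: set_upt atLeastLessThan_iff less_Suc_eq_le)
  ultimately obtain qs where qs: "path (observer S) w qs"
    "qs = map (\<lambda>l. ?M (i + l)) [0..<Suc (length w)]"
    by metis
  have "set qs \<subseteq> ?M ` {..length v}"
    unfolding qs(2) using len ij(1,2) by (auto simp del: upt_Suc)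
  moreover have "hd qs = last qs"
    unfolding qs(2) using len ij by (simp add: hd_map last_map del: upt_Suc)
  moreover have "reachable (observer S) (?M l)" for l
    using ne' lists(1) reachable_observer_iff[OF fsa] by blast
  then have "\<forall>q\<in>set qs. reachable (observer S) q"
    unfolding qs(2) by (simp del: upt_Suc)
  moreover have "w \<noteq> []"
    using len ij(1) by auto
  ultimately show ?thesis
    using qs(1) unfolding reachable_cycle_def transition_cycle_def by blast
qed

text \<open>Failure is used for one bound \<open>k\<close> only; the sequence and the prefix
  obtained may depend on it.\<close>

lemma not_detectableE:
  assumes "\<not> strongly_periodically_D_detectable S Tspec" "0 < k"
  obtains s s' where "s \<in> omega_language S" "prefix_of_omega s' s"
    and "\<And>s''. s'' \<in> lists (alphabet S) \<Longrightarrow> length (label_word S s'') < k \<Longrightarrow>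
      prefix_of_omega (s' @ s'') s \<Longrightarrow>
      (state_estimate S (label_word S (s' @ s'')) \<times>
       state_estimate S (label_word S (s' @ s''))) \<inter> Tspec \<noteq> {}"
proof -
  let ?good = "\<lambda>s s'. \<exists>s''\<in>lists (alphabet S). length (label_word S s'') < k \<and>
    prefix_of_omega (s' @ s'') s \<and>
    (state_estimate S (label_word S (s' @ s'')) \<times>
     state_estimate S (label_word S (s' @ s''))) \<inter> Tspec = {}"
  have "\<not> (\<forall>s\<in>omega_language S. \<forall>s'. prefix_of_omega s' s \<longrightarrow> ?good s s')"
  proof
    assume *: "\<forall>s\<in>omega_language S. \<forall>s'. prefix_of_omega s' s \<longrightarrow> ?good s s'"
    have "strongly_periodically_D_detectable S Tspec"
      unfolding strongly_periodically_D_detectable_def by (intro exI[of _ k] conjI assms(2) *)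
    with assms(1) show False ..
  qed
  then obtain s s' where "s \<in> omega_language S" "prefix_of_omega s' s" "\<not> ?good s s'"
    by blast
  then show thesis
    by (intro that[of s s']) blast+
qed

text \<open>The first alternative has no \<open>s1\<close>: a repeated state of the run lies in the
  estimate at its own position, so the cycle can start there.\<close>

lemma cycle_if_not_detectable:
  assumes fsa: "is_fsa S" and nd: "\<not> strongly_periodically_D_detectable S Tspec"
  shows "(\<exists>q x. reachable (observer S) q \<and> x \<in> q \<and> (q \<times> q) \<inter> Tspec \<noteq> {} \<and>
       (\<exists>s2 \<in> lists (unobservable S) - {[]}. steps S x s2 x)) \<or>
    (\<exists>w qs. reachable_cycle (observer S) w qs \<and> (\<forall>q \<in> set qs. (q \<times> q) \<inter> Tspec \<noteq> {}))"
proof -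
  let ?bad = "\<lambda>q. (q \<times> q) \<inter> Tspec \<noteq> {}" and ?K = "card (Pow (states S))"
  obtain s s' where s: "s \<in> omega_language S" "prefix_of_omega s' s"
    \<comment> \<open>The bound \<open>Suc ?K\<close> makes estimates bad up to and including
      \<open>?K\<close> further outputs.\<close>
    and bad: "\<And>s''. s'' \<in> lists (alphabet S) \<Longrightarrow> length (label_word S s'') < Suc ?K \<Longrightarrow>
      prefix_of_omega (s' @ s'') s \<Longrightarrow> ?bad (state_estimate S (label_word S (s' @ s'')))"
    using not_detectableE[OF nd zero_less_Suc] by metis
  with s obtain r where r: "r 0 \<in> initials S" "range r \<subseteq> states S"
      "\<And>i. (r i, s i, r (Suc i)) \<in> trans_rel S"
    by (auto simp: omega_language_def)
  define n where "n = length s'"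
  have s': "s' = prefix n s" using s(2) by (simp add: n_def prefix_of_omega_def)
  have split: "prefix j s = s' @ s[n \<rightarrow> j]" if "n \<le> j" for j
    using subsequence_split[of 0 n j s] that s' by simp
  \<comment> \<open>The state of the run shows that the estimate is nonempty, and later serves as
    \<open>x\<close>.\<close>
  have est: "r j \<in> state_estimate S (label_word S (prefix j s))" for j
    using steps_subsequence[of r s S 0 j] r state_estimate_iff[OF fsa] by blast
  have lists: "s[i \<rightarrow> j] \<in> lists (alphabet S)" for i j
    using s(1) by (auto simp: omega_language_def image_subset_iff)
  have outs: "label_word S (s[i \<rightarrow> j]) \<in> lists (outputs S)" for i j
    using label_word_in_lists[OF fsa lists] .
  have bad': "?bad (state_estimate S (label_word S (prefix j s)))"
    if "n \<le> j" "length (label_word S (s[n \<rightarrow> j])) \<le> ?K" for j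
    using bad[of "s[n \<rightarrow> j]"] that split[of j] lists by (auto simp: prefix_of_omega_def n_def)
  show ?thesis
  proof (cases "\<forall>j\<ge>n. length (label_word S (s[n \<rightarrow> j])) < ?K")
    case True
    then obtain i s2 where i: "n \<le> i" "s2 \<in> lists (unobservable S) - {[]}" "steps S (r i) s2 (r i)"
      using unobservable_cycle_if_bounded[OF fsa r] by blast
    then have "?bad (state_estimate S (label_word S (prefix i s)))"
      using bad' True by (simp add: less_imp_le)
    moreover have "reachable (observer S) (state_estimate S (label_word S (prefix i s)))"
      unfolding reachable_observer_iff[OF fsa] using est[of i] outs[of 0 i] by blast
    ultimately show ?thesis
      using est[of i] i(2,3) by (intro disjI1 exI bexI conjI)
  next
    case False
    then obtain j where j: "n \<le> j" "?K \<le> length (label_word S (s[n \<rightarrow> j]))"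
      by (auto simp: not_less)
    \<comment> \<open>Truncation to exactly \<open>?K\<close> outputs leaves \<open>v\<close> long
      enough for the pigeonhole argument and short enough for \<open>bad'\<close>.\<close>
    define v where "v = take ?K (label_word S (s[n \<rightarrow> j]))"
    have pre: "state_estimate S (label_word S s' @ take l v) \<noteq> {} \<and>
        ?bad (state_estimate S (label_word S s' @ take l v))" for l
    proof -
      \<comment> \<open>Every prefix of \<open>v\<close> is the label of an initial part of the
        events after \<open>n\<close>, so its estimate occurs along \<open>s\<close>, at position
        \<open>n + length s1\<close>.\<close>
      obtain s1 s2 where s12: "s[n \<rightarrow> j] = s1 @ s2" "label_word S s1 = take l v"
        using label_word_eq_append[of S "s[n \<rightarrow> j]" "take l v"] unfolding v_def
        by (metis append_take_drop_id take_take)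
      then have "s1 = take (length s1) (s[n \<rightarrow> j])" "length s1 \<le> j - n"
        by (metis append_eq_conv_conj) (metis le_add1 length_append s12(1) subsequence_length)
      then have "s1 = s[n \<rightarrow> n + length s1]"
        using j(1) by (simp add: min_absorb1)
      then have "label_word S (prefix (n + length s1) s) = label_word S s' @ take l v"
        and "length (label_word S (s[n \<rightarrow> n + length s1])) \<le> ?K"
        using split[of "n + length s1"] s12(2) by (auto simp: v_def)
      then show ?thesis
        using bad'[of "n + length s1"] est[of "n + length s1"] by auto
    qed
    have "v \<in> lists (outputs S)"
      using outs[of n j] by (auto simp: v_def dest: in_set_takeD)
    moreover have "label_word S s' \<in> lists (outputs S)"
      using outs s' by metis
    moreover have "?K \<le> length v" using j(2) by (simp add: v_def)
    moreover have "state_estimate S (label_word S s' @ v) \<noteq> {}"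
      using pre[of "length v"] by simp
    ultimately obtain w qs where qs: "reachable_cycle (observer S) w qs"
      "set qs \<subseteq> (\<lambda>l. state_estimate S (label_word S s' @ take l v)) ` {..length v}"
      using observer_cycle_if_long[OF fsa] by blast
    have "?bad q" if "q \<in> set qs" for q
    proof -
      obtain l where "q = state_estimate S (label_word S s' @ take l v)"
        using qs(2) \<open>q \<in> set qs\<close> by blast
      then show ?thesis using pre by simp
    qed
    then have "\<forall>q\<in>set qs. ?bad q" ..
    with qs(1) show ?thesis by (intro disjI2 exI[of _ w] exI[of _ qs] conjI)
  qed
qed

theorem theorem4p14:
  fixes S :: "('x, 't, 'o) fsa" and Tspec :: "('x \<times> 'x) set"
  assumes "is_fsa S" and "Tspec \<subseteq> states S \<times> states S"
  shows "\<not> strongly_periodically_D_detectable S Tspec \<longleftrightarrow>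
    (\<exists>q x. q \<in> Pow (states S) \<and> reachable (observer S) q \<and> x \<in> q \<and> (q \<times> q) \<inter> Tspec \<noteq> {} \<and>
       (\<exists>s1 \<in> lists (unobservable S). \<exists>s2 \<in> lists (unobservable S) - {[]}. \<exists>x' \<in> states S.
          steps S x s1 x' \<and> steps S x' s2 x')) \<or>
    (\<exists>w qs. reachable_cycle (observer S) w qs \<and> (\<forall>q \<in> set qs. (q \<times> q) \<inter> Tspec \<noteq> {}))"
  (is "_ \<longleftrightarrow> ?unobs \<or> ?cycle")
proof
  assume "\<not> strongly_periodically_D_detectable S Tspec"
  from cycle_if_not_detectable[OF assms(1) this] show "?unobs \<or> ?cycle"
  proof
    assume "\<exists>q x. reachable (observer S) q \<and> x \<in> q \<and> (q \<times> q) \<inter> Tspec \<noteq> {} \<and>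
       (\<exists>s2 \<in> lists (unobservable S) - {[]}. steps S x s2 x)"
    then obtain q x s2 where q: "reachable (observer S) q" "x \<in> q" "(q \<times> q) \<inter> Tspec \<noteq> {}"
      "s2 \<in> lists (unobservable S) - {[]}" "steps S x s2 x"
      by blast
    \<comment> \<open>The cycle already starts at \<open>x\<close>, so \<open>s1\<close> is taken
      empty and \<open>x'\<close> is \<open>x\<close>.\<close>
    then have "q \<in> Pow (states S)" "x \<in> states S" "steps S x [] x"
      by (auto simp: reachable_def observer_def steps_Nil dest: steps_states)
    then have ?unobs
      using q by (intro exI[of _ q] exI[of _ x] conjI bexI[of _ "[]"] bexI[of _ s2] bexI[of _ x]) auto
    then show ?thesis ..
  qed (rule disjI2)
next
  assume "?unobs \<or> ?cycle"
  then show "\<not> strongly_periodically_D_detectable S Tspec"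
    using unobservable_cycle_not_detectable[OF assms(1)] observer_cycle_not_detectable[OF assms(1)]
    by blast
qed

end
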